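(* Let $m,n\ge 1$ and let $\mathcal{G}=([m],E)$ be an undirected graph. Suppose that $n\ge \max_{i\in[m]}|{\downarrow} i|$. Let $U\subseteq\mathbb{R}^{m\times n}$ be the set of matrices $\mathbf{x}$ such that $\mathbf{x}[{\downarrow} i]$ has full rank $|{\downarrow} i|$ for every $i\in[m]$. Then the map $$\tau: U\to\prod_{\bar i\in[m]/\sim}\mathbb{R}^{n\times n},\qquad \mathbf{x}\mapsto\Bigl(\mathbf{x}[{\downarrow} i]^T\bigl(\mathbf{x}[{\downarrow} i]\,\mathbf{x}[{\downarrow} i]^T\bigr)^{-1}\mathbf{x}[{\downarrow} i]\Bigr)_{\bar i\in[m]/\sim}$$ is a maximal $G^0$-invariant; that is, $\tau(g\mathbf{x})=\tau(\mathbf{x})$ for all $g\in G^0$ and $\mathbf{x}\in U$, and whenever $\mathbf{x},\mathbf{y}\in U$ satisfy $\tau(\mathbf{x})=\tau(\mathbf{y})$ there exists $g\in G^0$ with $g\mathbf{x}=\mathbf{y}$.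
   Context: Graphs are finite and simple, $[m]=\{1,\dots,m\}$, and $E$ is a set of two-element subsets of $[m]$. Writing $N(i)=\{j\in[m] : \{i,j\}\in E\}$, the pre-order $\preccurlyeq$ on $[m]$ is defined by $i\preccurlyeq j$ if and only if $N(j)\cup\{j\}\subseteq N(i)\cup\{i\}$, and ${\downarrow} i=\{j\in[m] : j\preccurlyeq i\}$. The equivalence relation $\sim$ is defined by $i\sim j$ iff $i\preccurlyeq j$ and $j\preccurlyeq i$; $\bar i$ is the class of $i$, and ${\downarrow} i$ depends only on $\bar i$. For $\mathbf{x}\in\mathbb{R}^{m\times n}$, $\mathbf{x}[{\downarrow} i]\in\mathbb{R}^{|{\downarrow} i|\times n}$ is the submatrix consisting of the rows indexed by ${\downarrow} i$. The group $G^0=\{g\in\mathrm{GL}_m(\mathbb{R}) \mid g_{ij}=0 \text{ for all } i,j\text{ with } j\not\preccurlyeq i\}$ acts on $\mathbb{R}^{m\times n}$ by left multiplication. *)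

theory Defs
  imports
    "HOL-Library.FuncSet"
    "Jordan_Normal_Form.Gauss_Jordan_Elimination"
    "Jordan_Normal_Form.DL_Rank"
    "Jordan_Normal_Form.DL_Submatrix"
begin

text \<open>
  Matrices of \<^theory>\<open>Jordan_Normal_Form.Matrix\<close> are indexed from 0, so the vertex set
  \<open>[m]\<close> is \<open>{..<m}\<close> throughout.
\<close>

definition simple_graph :: "nat \<Rightarrow> nat set set \<Rightarrow> bool" where
  "simple_graph m E \<longleftrightarrow> (\<forall>e\<in>E. e \<subseteq> {..<m} \<and> card e = 2)"

definition nbrs :: "nat \<Rightarrow> nat set set \<Rightarrow> nat \<Rightarrow> nat set" where
  "nbrs m E i = {j \<in> {..<m}. {i, j} \<in> E}"

definition preceq :: "nat \<Rightarrow> nat set set \<Rightarrow> nat \<Rightarrow> nat \<Rightarrow> bool" where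
  "preceq m E i j \<longleftrightarrow> nbrs m E j \<union> {j} \<subseteq> nbrs m E i \<union> {i}"

definition down :: "nat \<Rightarrow> nat set set \<Rightarrow> nat \<Rightarrow> nat set" where
  "down m E i = {j \<in> {..<m}. preceq m E j i}"

definition sim :: "nat \<Rightarrow> nat set set \<Rightarrow> (nat \<times> nat) set" where
  "sim m E = {(i, j). i < m \<and> j < m \<and> preceq m E i j \<and> preceq m E j i}"

text \<open>
  The set \<open>\<down>i\<close> depends only on the class of \<open>i\<close>; \<open>down_class\<close> is the induced map on
  classes (see \<open>down_class_eq\<close> below).
\<close>

definition down_class :: "nat \<Rightarrow> nat set set \<Rightarrow> nat set \<Rightarrow> nat set" where
  "down_class m E C = the_elem (down m E ` C)"

lemma equiv_sim: "equiv {..<m} (sim m E)"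
  by (rule equivI) (auto simp: sim_def preceq_def refl_on_def sym_def trans_def)

lemma down_cong: "(i, j) \<in> sim m E \<Longrightarrow> down m E i = down m E j"
  by (auto simp: sim_def down_def preceq_def)

lemma down_class_eq:
  assumes "i < m"
  shows "down_class m E (sim m E `` {i}) = down m E i"
proof -
  have "i \<in> sim m E `` {i}"
    using assms by (auto simp: sim_def preceq_def)
  moreover have "down m E j = down m E i" if "j \<in> sim m E `` {i}" for j
    using that down_cong[of i j m E] by simp
  ultimately have "down m E ` (sim m E `` {i}) = {down m E i}"
    by (metis (no_types, lifting) empty_iff image_constant_conv image_cong)
  then show ?thesis
    by (simp add: down_class_def)
qed

abbreviation row_submatrix :: "real mat \<Rightarrow> nat set \<Rightarrow> real mat" where
  "row_submatrix x I \<equiv> submatrix x I UNIV"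

definition G0 :: "nat \<Rightarrow> nat set set \<Rightarrow> real mat set" where
  "G0 m E = {g \<in> carrier_mat m m. invertible_mat g \<and>
     (\<forall>i<m. \<forall>j<m. \<not> preceq m E j i \<longrightarrow> g $$ (i, j) = 0)}"

text \<open>
  The argument of \<^const>\<open>vec_space.rank\<close> is the length of the columns, that is, the number
  of rows of the matrix.
\<close>

definition U :: "nat \<Rightarrow> nat \<Rightarrow> nat set set \<Rightarrow> real mat set" where
  "U m n E = {x \<in> carrier_mat m n. \<forall>i<m.
     vec_space.rank (card (down m E i)) (row_submatrix x (down m E i)) = card (down m E i)}"

text \<open>
  If \<open>A * A\<^sup>T\<close> is singular then \<^const>\<open>mat_inverse\<close> is \<^const>\<open>None\<close> and the value below is
  meaningless. This does not happen when the rows of \<open>A\<close> are linearly independent, as they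
  are for the submatrices used in \<open>tau\<close> when \<open>x\<close> is in \<open>U m n E\<close>.
\<close>

definition row_proj :: "real mat \<Rightarrow> real mat" where
  "row_proj A = transpose_mat A * the (mat_inverse (A * transpose_mat A)) * A"

definition tau :: "nat \<Rightarrow> nat set set \<Rightarrow> real mat \<Rightarrow> nat set \<Rightarrow> real mat" where
  "tau m E x = (\<lambda>C\<in>{..<m} // sim m E. row_proj (row_submatrix x (down_class m E C)))"

text \<open>
  The condition \<open>act g x \<in> X\<close> says that \<open>X\<close> is stable under the action, which is needed for
  \<open>f (act g x)\<close> to make sense when \<open>f\<close> is only a function on \<open>X\<close>.
\<close>

definition maximal_invariant ::
  "'g set \<Rightarrow> ('g \<Rightarrow> 'x \<Rightarrow> 'x) \<Rightarrow> 'x set \<Rightarrow> ('x \<Rightarrow> 'y) \<Rightarrow> bool" where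
  "maximal_invariant G act X f \<longleftrightarrow>
     (\<forall>g\<in>G. \<forall>x\<in>X. act g x \<in> X \<and> f (act g x) = f x) \<and>
     (\<forall>x\<in>X. \<forall>y\<in>X. f x = f y \<longrightarrow> (\<exists>g\<in>G. act g x = y))"

end

theory Submission
  imports Defs
begin

text \<open>
  Let \<open>D = \<down>i\<close>, and let \<open>S\<close> be the 0/1 matrix with \<open>x[D] = S x\<close> (\<open>selector\<close>). If \<open>x[D]\<close> has
  full row rank, its Gram matrix is invertible and \<open>row_proj x[D]\<close> is the orthogonal projection
  onto the row space of \<open>x[D]\<close>. A change of basis of the row space leaves this projection
  unchanged (\<open>row_proj_mult_left\<close>), and two matrices with the same projection differ by a square
  left factor (\<open>row_proj_eq_imp_factor\<close>). So \<open>tau\<close> records, for each \<open>i\<close>, the row space of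
  \<open>x[\<down>i]\<close> and nothing more.

  Since \<open>D\<close> is closed downwards, the rows of \<open>g \<in> G0\<close> indexed by \<open>D\<close> vanish outside the
  columns in \<open>D\<close>. Hence \<open>(g x)[D] = C x[D]\<close> for the diagonal block \<open>C = S g S\<^sup>T\<close>
  (\<open>compression_mult\<close>), and \<open>C\<close> inherits invertibility from \<open>g\<close>. This gives both the stability
  of \<open>U\<close> and the invariance of \<open>tau\<close>.

  Conversely, if \<open>tau x = tau y\<close> then \<open>y[\<down>i] = h\<^sub>i x[\<down>i]\<close> for every \<open>i\<close>. As \<open>i \<in> \<down>i\<close>, this
  expresses row \<open>i\<close> of \<open>y\<close> as a combination of the rows of \<open>x\<close> in \<open>\<down>i\<close>; the coefficients
  are the \<open>i\<close>-th row of a matrix \<open>g\<close> that has the zero pattern of \<open>G0\<close> and satisfies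
  \<open>g x = y\<close>. Different \<open>i\<close> use unrelated matrices \<open>h\<^sub>i\<close>, so the invertibility of \<open>g\<close> needs an
  argument: every diagonal block \<open>C\<close> of \<open>g\<close> satisfies \<open>C x[\<down>i] = y[\<down>i]\<close>, which has full rank,
  so \<open>C\<close> is invertible; and a matrix with this zero pattern whose diagonal blocks are all
  invertible has trivial kernel (\<open>G0I\<close>).
\<close>

section \<open>Full row rank\<close>

text \<open>
  A right inverse is an equational witness of full rank, so it can be carried through matrix
  products. Both sides say that the columns span the whole space: the columns of a right inverse
  are preimages of the unit vectors.
\<close>

lemma full_row_rank_iff_right_inverse:
  fixes A :: "'a::field mat"
  assumes A: "A \<in> carrier_mat d n"
  shows "vec_space.rank d A = d \<longleftrightarrow> (\<exists>R\<in>carrier_mat n d. A * R = 1\<^sub>m d)"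
proof -
  interpret vec_space "TYPE('a)" d .
  have sub: "set (cols A) \<subseteq> carrier_vec d"
    using A cols_dim by blast
  have "rank A = d \<longleftrightarrow> span (set (cols A)) = carrier_vec d"
  proof
    assume rk: "rank A = d"
    obtain B where B: "maximal B (\<lambda>T. T \<subseteq> set (cols A) \<and> lin_indpt T)"
      using maximal_exists_superset[of "set (cols A)" "\<lambda>T. T \<subseteq> set (cols A) \<and> lin_indpt T" "{}"]
      by (auto simp: lin_dep_def)
    have Bsub: "B \<subseteq> set (cols A)" and Bli: "lin_indpt B"
      using B by (auto simp: maximal_def)
    have "card B = dim"
      using rank_card_indpt[OF A B] rk dim_is_n by simp
    then have "basis B"
      using Bsub sub finite_subset[OF Bsub] by (intro dim_li_is_basis[OF fin_dim _ _ Bli]) auto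
    then have "span B = carrier_vec d"
      by (simp add: basis_def)
    then show "span (set (cols A)) = carrier_vec d"
      using span_is_monotone[OF Bsub] span_is_subset2[OF sub] by auto
  next
    assume "span (set (cols A)) = carrier_vec d"
    then have "rank A = vectorspace.dim class_ring (vs (carrier_vec d))"
      unfolding rank_def by (simp only:)
    also have "vs (carrier_vec d) = V"
      by (simp add: module_vec_def)
    finally show "rank A = d"
      using dim_is_n by simp
  qed
  also have "\<dots> \<longleftrightarrow> (\<forall>b\<in>carrier_vec d. \<exists>c\<in>carrier_vec n. A *\<^sub>v c = b)"
  proof -
    have "span (set (cols A)) = {b \<in> carrier_vec d. \<exists>c\<in>carrier_vec n. A *\<^sub>v c = b}"
      using col_space_eq[OF A] A unfolding col_space_def by simp
    then show ?thesis
      by blast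
  qed
  also have "\<dots> \<longleftrightarrow> (\<exists>R\<in>carrier_mat n d. A * R = 1\<^sub>m d)"
  proof
    assume "\<forall>b\<in>carrier_vec d. \<exists>c\<in>carrier_vec n. A *\<^sub>v c = b"
    then have "\<forall>j. \<exists>c\<in>carrier_vec n. A *\<^sub>v c = unit_vec d j"
      by simp
    then obtain c where c: "\<And>j. c j \<in> carrier_vec n" "\<And>j. A *\<^sub>v c j = unit_vec d j"
      by metis
    define R where "R = mat_of_cols n (map c [0..<d])"
    have R: "R \<in> carrier_mat n d"
      by (simp add: R_def mat_of_cols_def)
    have "col (A * R) j = col (1\<^sub>m d) j" if "j < d" for j
    proof -
      have "col (A * R) j = A *\<^sub>v col R j"
        using that by (rule col_mult2[OF A R])
      also have "col R j = c j"
        using that c(1) by (simp add: R_def)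
      finally show ?thesis
        using that c(2) by simp
    qed
    then have "A * R = 1\<^sub>m d"
      using A R by (intro mat_col_eqI) auto
    then show "\<exists>R\<in>carrier_mat n d. A * R = 1\<^sub>m d"
      using R by blast
  next
    assume "\<exists>R\<in>carrier_mat n d. A * R = 1\<^sub>m d"
    then obtain R where R: "R \<in> carrier_mat n d" "A * R = 1\<^sub>m d"
      by blast
    show "\<forall>b\<in>carrier_vec d. \<exists>c\<in>carrier_vec n. A *\<^sub>v c = b"
    proof
      fix b :: "'a vec" assume b: "b \<in> carrier_vec d"
      have "A *\<^sub>v (R *\<^sub>v b) = b"
        using assoc_mult_mat_vec[OF A R(1) b] R(2) b by simp
      then show "\<exists>c\<in>carrier_vec n. A *\<^sub>v c = b"
        using R(1) b by (meson mult_mat_vec_carrier)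
    qed
  qed
  finally show ?thesis .
qed

section \<open>The projection onto the row space\<close>

lemma det_nonzero_mat_inverse:
  fixes A :: "'a::field mat"
  assumes A: "A \<in> carrier_mat d d" and det: "det A \<noteq> 0"
  obtains B where "mat_inverse A = Some B" "B \<in> carrier_mat d d" "A * B = 1\<^sub>m d" "B * A = 1\<^sub>m d"
proof (cases "mat_inverse A")
  case None
  then show ?thesis
    using mat_inverse(1)[OF A None, where b = "()"] det_non_zero_imp_unit[OF A det, where b = "()"]
    by blast
next
  case (Some B)
  then show ?thesis
    using mat_inverse(2)[OF A Some] that by blast
qed

text \<open>
  If \<open>A A\<^sup>T v = 0\<close> then \<open>\<parallel>A\<^sup>T v\<parallel>\<^sup>2 = v \<bullet> A A\<^sup>T v = 0\<close>, hence \<open>A\<^sup>T v = 0\<close>, and \<open>R\<^sup>T\<close> is a left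
  inverse of \<open>A\<^sup>T\<close>. So the Gram matrix has trivial kernel, and \<^const>\<open>row_proj\<close>
  is computed from a genuine inverse.
\<close>

lemma gram_inverse:
  fixes A :: "real mat"
  assumes A: "A \<in> carrier_mat d n" and R: "R \<in> carrier_mat n d" and AR: "A * R = 1\<^sub>m d"
  obtains H where "H \<in> carrier_mat d d" "A * A\<^sup>T * H = 1\<^sub>m d" "H * (A * A\<^sup>T) = 1\<^sub>m d"
    "row_proj A = A\<^sup>T * H * A"
proof -
  let ?G = "A * A\<^sup>T"
  have AT: "A\<^sup>T \<in> carrier_mat n d" and G: "?G \<in> carrier_mat d d"
    using A by auto
  have RA: "R\<^sup>T * A\<^sup>T = 1\<^sub>m d"
    using transpose_mult[OF A R] AR by simp
  have "v = 0\<^sub>v d" if v: "v \<in> carrier_vec d" and Gv: "?G *\<^sub>v v = 0\<^sub>v d" for v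
  proof -
    define w where "w = A\<^sup>T *\<^sub>v v"
    have w: "w \<in> carrier_vec n"
      using AT v by (simp add: w_def)
    have Aw: "A *\<^sub>v w = 0\<^sub>v d"
      using assoc_mult_mat_vec[OF A AT v] Gv by (simp add: w_def)
    \<comment> \<open>Definiteness is available for \<open>\<bullet>c\<close>; conjugation is trivial on the reals.\<close>
    have "w \<bullet>c w = w \<bullet> w"
      by (simp add: scalar_prod_def)
    also have "\<dots> = v \<bullet> (A *\<^sub>v w)"
      using transpose_vec_mult_scalar[OF A w v] w_def by simp
    also have "\<dots> = 0"
      using Aw v by simp
    finally have "w = 0\<^sub>v n"
      by (rule iffD1[OF conjugate_square_eq_0_vec[OF w]])
    then have "R\<^sup>T *\<^sub>v (A\<^sup>T *\<^sub>v v) = 0\<^sub>v d"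
      using R by (auto simp: w_def)
    moreover have "R\<^sup>T *\<^sub>v (A\<^sup>T *\<^sub>v v) = v"
      using assoc_mult_mat_vec[of "R\<^sup>T" d n "A\<^sup>T" d v] R AT v RA by simp
    ultimately show ?thesis by simp
  qed
  then have "det ?G \<noteq> 0"
    using det_0_iff_vec_prod_zero_field[OF G] by blast
  then obtain H where "mat_inverse ?G = Some H" "H \<in> carrier_mat d d"
      "?G * H = 1\<^sub>m d" "H * ?G = 1\<^sub>m d"
    using det_nonzero_mat_inverse[OF G] by metis
  then show ?thesis
    by (intro that[of H]) (auto simp: row_proj_def)
qed

lemma row_proj_carrier:
  assumes "A \<in> carrier_mat d n" "R \<in> carrier_mat n d" "A * R = 1\<^sub>m d"
  shows "row_proj A \<in> carrier_mat n n"
proof -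
  obtain H where "H \<in> carrier_mat d d" "row_proj A = A\<^sup>T * H * A"
    using gram_inverse[OF assms] .
  then show ?thesis using assms by simp
qed

lemma mult_row_proj:
  assumes A: "A \<in> carrier_mat d n" "R \<in> carrier_mat n d" "A * R = 1\<^sub>m d"
  shows "A * row_proj A = A"
proof -
  obtain H where H: "H \<in> carrier_mat d d" "A * A\<^sup>T * H = 1\<^sub>m d" "row_proj A = A\<^sup>T * H * A"
    using gram_inverse[OF A] .
  have "A * row_proj A = A * (A\<^sup>T * H) * A"
    unfolding H(3) using A(1) H(1) by (subst assoc_mult_mat[of A d n "A\<^sup>T * H" d A n]) auto
  also have "A * (A\<^sup>T * H) = A * A\<^sup>T * H"
    using A(1) H(1) by (subst assoc_mult_mat[of A d n "A\<^sup>T" d H d]) auto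
  finally show ?thesis
    using H(2) A(1) by simp
qed

text \<open>
  The factor \<open>h\<close> cancels because the Gram matrix becomes \<open>h G h\<^sup>T\<close>, whose inverse is
  \<open>k\<^sup>T G\<^sup>-\<^sup>1 k\<close>. The first claim keeps track of the full rank of \<open>h A\<close>.
\<close>

lemma row_proj_mult_left:
  assumes A: "A \<in> carrier_mat d n" "R \<in> carrier_mat n d" "A * R = 1\<^sub>m d"
    and h: "h \<in> carrier_mat d d" and k: "k \<in> carrier_mat d d" and hk: "h * k = 1\<^sub>m d"
  shows "h * A * (R * k) = 1\<^sub>m d" and "row_proj (h * A) = row_proj A"
proof -
  have hA: "h * A \<in> carrier_mat d n" and Rk: "R * k \<in> carrier_mat n d"
    using A h k by auto
  have "h * A * (R * k) = h * (A * (R * k))"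
    using h A(1) Rk by (rule assoc_mult_mat)
  also have "A * (R * k) = A * R * k"
    using A(1,2) k by (rule assoc_mult_mat[symmetric])
  finally show hARk: "h * A * (R * k) = 1\<^sub>m d"
    using A(3) k hk by simp
  define G where "G = A * A\<^sup>T"
  have AT: "A\<^sup>T \<in> carrier_mat n d" and hT: "h\<^sup>T \<in> carrier_mat d d" and G: "G \<in> carrier_mat d d"
    using A(1) h by (auto simp: G_def)
  obtain H where H: "H \<in> carrier_mat d d" "H * G = 1\<^sub>m d" "row_proj A = A\<^sup>T * H * A"
    using gram_inverse[OF A] unfolding G_def .
  obtain H' where H': "H' \<in> carrier_mat d d" "h * A * (h * A)\<^sup>T * H' = 1\<^sub>m d"
      "row_proj (h * A) = (h * A)\<^sup>T * H' * (h * A)"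
    using gram_inverse[OF hA Rk hARk] .
  have tr: "(h * A)\<^sup>T = A\<^sup>T * h\<^sup>T"
    using h A(1) by (rule transpose_mult)
  have "h * A * (h * A)\<^sup>T = h * (A * (A\<^sup>T * h\<^sup>T))"
    unfolding tr using h A(1) AT hT by (intro assoc_mult_mat) auto
  also have "A * (A\<^sup>T * h\<^sup>T) = G * h\<^sup>T"
    unfolding G_def using A(1) AT hT by (rule assoc_mult_mat[symmetric])
  finally have 1: "h * (G * h\<^sup>T) * H' = 1\<^sub>m d"
    using H'(2) by simp
  define L where "L = h\<^sup>T * H'"
  have L: "L \<in> carrier_mat d d"
    using hT H'(1) by (simp add: L_def)
  have "h * (G * h\<^sup>T) * H' = h * (G * L)"
    unfolding L_def using h G hT H'(1) by (simp add: assoc_mult_mat[of _ d d _ d _ d])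
  then have "G * L * h = 1\<^sub>m d"
    using mat_mult_left_right_inverse[of h d "G * L"] 1 h G L by simp
  then have GL: "G * (L * h) = 1\<^sub>m d"
    using assoc_mult_mat[OF G L h] by simp
  \<comment> \<open>\<open>L * h\<close> and \<open>H\<close> are both inverse to \<open>G\<close>, so they agree.\<close>
  have "L * h = (H * G) * (L * h)"
    using H L h by simp
  also have "\<dots> = H * (G * (L * h))"
    using H(1) G L h by (intro assoc_mult_mat) auto
  finally have LH: "L * h = H"
    using GL H(1) by simp
  have "row_proj (h * A) = A\<^sup>T * h\<^sup>T * H' * (h * A)"
    using H'(3) tr by simp
  also have "A\<^sup>T * h\<^sup>T * H' = A\<^sup>T * L"
    unfolding L_def using AT hT H'(1) by (rule assoc_mult_mat)
  also have "A\<^sup>T * L * (h * A) = A\<^sup>T * L * h * A"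
    using AT L h A(1) by (intro assoc_mult_mat[symmetric]) auto
  also have "A\<^sup>T * L * h = A\<^sup>T * (L * h)"
    using AT L h by (rule assoc_mult_mat)
  finally show "row_proj (h * A) = row_proj A"
    using LH H(3) by simp
qed

text \<open>
  \<open>B\<close> is fixed by its own projection, and the projection of \<open>A\<close> ends in a factor \<open>A\<close>.
\<close>

lemma row_proj_eq_imp_factor:
  assumes A: "A \<in> carrier_mat d n" "R \<in> carrier_mat n d" "A * R = 1\<^sub>m d"
    and B: "B \<in> carrier_mat d n" "Q \<in> carrier_mat n d" "B * Q = 1\<^sub>m d"
    and eq: "row_proj A = row_proj B"
  obtains h where "h \<in> carrier_mat d d" "B = h * A"
proof -
  obtain H where H: "H \<in> carrier_mat d d" "row_proj A = A\<^sup>T * H * A"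
    using gram_inverse[OF A] .
  have "B = B * (A\<^sup>T * H * A)"
    using mult_row_proj[OF B] eq H(2) by simp
  also have "\<dots> = B * (A\<^sup>T * H) * A"
    using A(1) B(1) H(1) by (intro assoc_mult_mat[symmetric]) auto
  finally show ?thesis
    using A(1) B(1) H(1) by (intro that[of "B * (A\<^sup>T * H)"]) auto
qed

section \<open>Selecting rows by left multiplication\<close>

text \<open>
  Writing row selection as a left multiplication turns every statement on submatrices into an
  identity of matrix products. As in \<^const>\<open>submatrix\<close>, the rows are listed in increasing order,
  so row \<open>i \<in> D\<close> lands at position \<open>card {a \<in> D. a < i}\<close>.
\<close>

definition selector :: "nat \<Rightarrow> nat set \<Rightarrow> 'a::semiring_1 mat" where
  "selector m D = mat (card D) m (\<lambda>(a, j). if pick D a = j then 1 else 0)"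

lemma pick_eq_iff:
  assumes "a < card D" "b < card D"
  shows "pick D a = pick D b \<longleftrightarrow> a = b"
  using assms card_pick[of a D] card_pick[of b D] by metis

lemma selector_carrier [simp]: "selector m D \<in> carrier_mat (card D) m"
  by (simp add: selector_def)

lemma selector_dims [simp]: "dim_row (selector m D) = card D" "dim_col (selector m D) = m"
  by (simp_all add: selector_def)

lemma selector_mult_carrier [simp]:
  "x \<in> carrier_mat m n \<Longrightarrow> selector m D * x \<in> carrier_mat (card D) n"
  by (rule mult_carrier_mat[OF selector_carrier])

lemma selector_mult_index:
  fixes x :: "'a::comm_semiring_1 mat"
  assumes "D \<subseteq> {..<m}" "x \<in> carrier_mat m n" "a < card D" "j < n"
  shows "(selector m D * x) $$ (a, j) = x $$ (pick D a, j)"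
proof -
  have p: "pick D a < m"
    using pick_in_set[of a D] assms by auto
  have "(selector m D * x) $$ (a, j) = (\<Sum>k = 0..<m. (if pick D a = k then 1 else 0) * x $$ (k, j))"
    using assms by (simp add: selector_def scalar_prod_def)
  also have "\<dots> = x $$ (pick D a, j)"
    using p by (simp add: if_distrib[of "\<lambda>c. c * _"] cong: if_cong)
  finally show ?thesis .
qed

lemma submatrix_conv_selector_mult:
  fixes x :: "'a::comm_semiring_1 mat"
  assumes "D \<subseteq> {..<m}" "x \<in> carrier_mat m n"
  shows "submatrix x D UNIV = selector m D * x"
proof -
  have "{i. i < m \<and> i \<in> D} = D"
    using assms(1) by auto
  then show ?thesis
    using assms by (intro eq_matI) (auto simp: dim_submatrix submatrix_index selector_mult_index pick_UNIV
      simp del: index_mult_mat(1))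
qed

lemma card_less_lt_card:
  fixes D :: "nat set"
  assumes "finite D" "i \<in> D"
  shows "card {a \<in> D. a < i} < card D"
  using assms by (intro psubset_card_mono) auto

lemma selector_mult_index_rank:
  fixes x :: "'a::comm_semiring_1 mat"
  assumes "D \<subseteq> {..<m}" "x \<in> carrier_mat m n" "i \<in> D" "j < n"
  shows "(selector m D * x) $$ (card {a \<in> D. a < i}, j) = x $$ (i, j)"
  using selector_mult_index[OF assms(1,2) card_less_lt_card assms(4)] pick_card_in_set[OF assms(3)]
    finite_subset[OF assms(1)] assms(3) by simp

lemma selector_mult_transpose:
  assumes "D \<subseteq> {..<m}"
  shows "selector m D * (selector m D)\<^sup>T = (1\<^sub>m (card D) :: 'a::comm_semiring_1 mat)"
proof (rule eq_matI)
  fix a b assume "a < dim_row (1\<^sub>m (card D) :: 'a mat)" "b < dim_col (1\<^sub>m (card D) :: 'a mat)"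
  then have a: "a < card D" and b: "b < card D" by auto
  have p: "pick D a < m"
    using pick_in_set[of a D] a assms(1) by auto
  have "(selector m D * (selector m D)\<^sup>T :: 'a mat) $$ (a, b)
    = (\<Sum>k = 0..<m. (if pick D a = k then 1 else 0) * (if pick D b = k then 1 else 0))"
    using a b by (simp add: selector_def scalar_prod_def)
  also have "\<dots> = (if pick D b = pick D a then 1 else 0)"
    using p by (simp add: if_distrib[of "\<lambda>c. c * _"] cong: if_cong)
  also have "\<dots> = (1\<^sub>m (card D) :: 'a mat) $$ (a, b)"
    using a b by (simp add: pick_eq_iff eq_commute)
  finally show "(selector m D * (selector m D)\<^sup>T :: 'a mat) $$ (a, b) = 1\<^sub>m (card D) $$ (a, b)" .
qed (simp_all add: selector_def)

text \<open>
  \<open>S\<^sup>T S\<close> is the coordinate projection onto \<open>D\<close>, so on the right it only erases the columns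
  outside \<open>D\<close>.
\<close>

lemma mult_selector_transpose_mult_selector:
  fixes M :: "'a::comm_semiring_1 mat"
  assumes D: "D \<subseteq> {..<m}" and M: "M \<in> carrier_mat r m"
    and zero: "\<And>a j. a < r \<Longrightarrow> j < m \<Longrightarrow> j \<notin> D \<Longrightarrow> M $$ (a, j) = 0"
  shows "M * (selector m D)\<^sup>T * selector m D = M"
proof -
  have fin: "finite D" using D finite_subset by blast
  have entry: "((selector m D)\<^sup>T * selector m D :: 'a mat) $$ (k, j) = (if k = j \<and> j \<in> D then 1 else 0)"
    if k: "k < m" and j: "j < m" for k j
  proof -
    have "((selector m D)\<^sup>T * selector m D :: 'a mat) $$ (k, j)
      = (\<Sum>a = 0..<card D. (if pick D a = k then 1 else 0) * (if pick D a = j then 1 else 0))"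
      using k j by (simp add: selector_def scalar_prod_def)
    also have "\<dots> = (\<Sum>a = 0..<card D. if pick D a = k \<and> k = j then 1 else 0)"
      by (intro sum.cong) auto
    also have "\<dots> = (if k = j \<and> j \<in> D then 1 else 0)"
    proof (cases "k = j \<and> j \<in> D")
      case True
      \<comment> \<open>The position of \<open>j\<close> in \<open>D\<close> contributes the only nonzero term.\<close>
      define a0 where "a0 = card {a \<in> D. a < j}"
      have a0: "a0 < card D"
        unfolding a0_def using True fin by (intro card_less_lt_card) auto
      have "pick D a0 = j"
        unfolding a0_def using True by (intro pick_card_in_set) simp
      then have "(pick D a = j) = (a = a0)" if "a < card D" for a
        using pick_eq_iff[OF that a0] by auto
      then have "(\<Sum>a = 0..<card D. if pick D a = k \<and> k = j then 1 else (0 :: 'a))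
        = (\<Sum>a = 0..<card D. if a = a0 then 1 else 0)"
        using True by (intro sum.cong) auto
      then show ?thesis
        using a0 True by simp
    next
      case False
      then show ?thesis
        using pick_in_set by (intro trans[OF sum.neutral]) auto
    qed
    finally show ?thesis .
  qed
  define P :: "'a mat" where "P = (selector m D)\<^sup>T * selector m D"
  have P: "P \<in> carrier_mat m m"
    unfolding P_def by (rule mult_carrier_mat[of _ m "card D"]) simp_all
  have "M * (selector m D)\<^sup>T * selector m D = M * P"
    unfolding P_def using M by (intro assoc_mult_mat[of _ r m _ "card D" _ m]) auto
  also have "\<dots> = M"
  proof (rule eq_matI)
    fix a j assume "a < dim_row M" "j < dim_col M"
    then have a: "a < r" and j: "j < m" using M by auto
    have "(M * P) $$ (a, j) = (\<Sum>k = 0..<m. M $$ (a, k) * P $$ (k, j))"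
      using a j M P by (auto simp: scalar_prod_def intro!: sum.cong)
    also have "\<dots> = (\<Sum>k = 0..<m. if k = j then (if j \<in> D then M $$ (a, j) else 0) else 0)"
      using j by (intro sum.cong) (auto simp: entry P_def simp del: index_mult_mat(1))
    also have "\<dots> = M $$ (a, j)"
      using j zero[OF a j] by auto
    finally show "(M * P) $$ (a, j) = M $$ (a, j)" .
  qed (use M P in auto)
  finally show ?thesis .
qed

text \<open>
  This is the diagonal block of \<open>g\<close> on \<open>D\<close>, that is \<^term>\<open>submatrix g D D\<close>, in product form.
\<close>

definition compression :: "nat \<Rightarrow> nat set \<Rightarrow> 'a::comm_semiring_1 mat \<Rightarrow> 'a mat" where
  "compression m D g = selector m D * g * (selector m D)\<^sup>T"

lemma compression_carrier [simp]:
  "g \<in> carrier_mat m m \<Longrightarrow> compression m D g \<in> carrier_mat (card D) (card D)"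
  unfolding compression_def by (rule mult_carrier_mat[of _ _ m]) simp_all

text \<open>
  The zero hypothesis says that the coordinate subspace of the vectors supported outside \<open>D\<close> is
  invariant under \<open>g\<close>; the compression is then the map induced by \<open>g\<close> on the quotient, to which
  \<open>S\<close> is the quotient map.
\<close>

lemma compression_mult_selector:
  fixes g :: "'a::comm_semiring_1 mat"
  assumes D: "D \<subseteq> {..<m}" and g: "g \<in> carrier_mat m m"
    and zero: "\<forall>i\<in>D. \<forall>j<m. j \<notin> D \<longrightarrow> g $$ (i, j) = 0"
  shows "compression m D g * selector m D = selector m D * g"
  unfolding compression_def
proof (rule mult_selector_transpose_mult_selector[OF D])
  show "selector m D * g \<in> carrier_mat (card D) m"
    using g by simp
  show "(selector m D * g) $$ (a, j) = 0" if "a < card D" "j < m" "j \<notin> D" for a j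
    using that zero pick_in_set[of a D] by (simp add: selector_mult_index[OF D g])
qed

lemma compression_mult:
  fixes g :: "'a::comm_semiring_1 mat"
  assumes D: "D \<subseteq> {..<m}" and g: "g \<in> carrier_mat m m"
    and zero: "\<forall>i\<in>D. \<forall>j<m. j \<notin> D \<longrightarrow> g $$ (i, j) = 0"
    and x: "x \<in> carrier_mat m n"
  shows "compression m D g * (selector m D * x) = selector m D * (g * x)"
proof -
  have "compression m D g * (selector m D * x) = compression m D g * selector m D * x"
    using g x by (intro assoc_mult_mat[symmetric, of _ "card D" "card D" _ m]) auto
  also have "\<dots> = selector m D * g * x"
    using compression_mult_selector[OF D g zero] by simp
  also have "\<dots> = selector m D * (g * x)"
    using g x by (intro assoc_mult_mat[of _ "card D" m]) auto
  finally show ?thesis .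
qed

text \<open>
  \<open>S g S\<^sup>T S g' S\<^sup>T = S g g' S\<^sup>T = S S\<^sup>T = 1\<close>, where the zero pattern of \<open>g\<close>
  removes the inner \<open>S\<^sup>T S\<close>.
\<close>

lemma compression_right_inverse:
  fixes g :: "'a::comm_semiring_1 mat"
  assumes D: "D \<subseteq> {..<m}" and g: "g \<in> carrier_mat m m"
    and zero: "\<forall>i\<in>D. \<forall>j<m. j \<notin> D \<longrightarrow> g $$ (i, j) = 0"
    and g': "g' \<in> carrier_mat m m" and inv: "g * g' = 1\<^sub>m m"
  shows "compression m D g * compression m D g' = 1\<^sub>m (card D)"
proof -
  have "compression m D g * compression m D g'
    = compression m D g * (selector m D * g') * (selector m D)\<^sup>T"
    unfolding compression_def[of m D g'] using g g'
    by (intro assoc_mult_mat[symmetric, of _ "card D" "card D" _ m]) auto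
  also have "compression m D g * (selector m D * g') = selector m D"
    unfolding compression_mult[OF D g zero g'] inv by (rule right_mult_one_mat[OF selector_carrier])
  finally show ?thesis
    using selector_mult_transpose[OF D] by simp
qed

section \<open>The order and its matrix group\<close>

lemma down_subset: "down m E i \<subseteq> {..<m}"
  by (auto simp: down_def)

lemma self_in_down: "i < m \<Longrightarrow> i \<in> down m E i"
  by (auto simp: down_def preceq_def)

lemma in_down_trans: "k \<in> down m E i \<Longrightarrow> preceq m E j k \<Longrightarrow> j < m \<Longrightarrow> j \<in> down m E i"
  by (auto simp: down_def preceq_def)

text \<open>
  Where the order enters: \<open>down m E i\<close> is closed downwards, so an entry in column \<open>j\<close> of a row
  in it can be nonzero only if \<open>j\<close> also lies in it.
\<close>

lemma order_pattern_zero_on_down: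
  assumes "\<forall>i<m. \<forall>j<m. \<not> preceq m E j i \<longrightarrow> g $$ (i, j) = 0"
  shows "\<forall>k\<in>down m E i. \<forall>j<m. j \<notin> down m E i \<longrightarrow> g $$ (k, j) = 0"
  using assms in_down_trans down_subset by blast

lemma invertible_mat_right_inverse:
  assumes "invertible_mat g" "g \<in> carrier_mat m m"
  obtains g' where "g' \<in> carrier_mat m m" "g * g' = 1\<^sub>m m"
proof -
  obtain B where B: "g * B = 1\<^sub>m m" "B * g = 1\<^sub>m (dim_row B)"
    using assms by (auto simp: invertible_mat_def inverts_mat_def)
  have "dim_col B = m"
    using arg_cong[OF B(1), of dim_col] by simp
  moreover have "dim_row B = m"
    using arg_cong[OF B(2), of dim_col] assms(2) by simp
  ultimately show ?thesis
    using that B(1) by blast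
qed

lemma det_nonzero_imp_invertible_mat:
  fixes g :: "'a::field mat"
  assumes g: "g \<in> carrier_mat m m" and "det g \<noteq> 0"
  shows "invertible_mat g"
proof -
  obtain B where "B \<in> carrier_mat m m" "g * B = 1\<^sub>m m" "B * g = 1\<^sub>m m"
    using det_nonzero_mat_inverse[OF assms] .
  then show ?thesis
    using g by (auto simp: invertible_mat_def inverts_mat_def)
qed

text \<open>
  A triangularity argument without a choice of linear extension of the order: if \<open>g v = 0\<close>, then
  each diagonal block kills the part of \<open>v\<close> on its set \<open>down m E i\<close>, so that part is zero; and
  these sets cover all indices.
\<close>

lemma G0I:
  assumes g: "g \<in> carrier_mat m m"
    and zero: "\<forall>i<m. \<forall>j<m. \<not> preceq m E j i \<longrightarrow> g $$ (i, j) = 0"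
    and inv: "\<And>i. i < m \<Longrightarrow> \<exists>k\<in>carrier_mat (card (down m E i)) (card (down m E i)).
      compression m (down m E i) g * k = 1\<^sub>m (card (down m E i))"
  shows "g \<in> G0 m E"
proof -
  have "v = 0\<^sub>v m" if v: "v \<in> carrier_vec m" and gv: "g *\<^sub>v v = 0\<^sub>v m" for v
  proof (rule eq_vecI)
    fix i assume "i < dim_vec (0\<^sub>v m :: real vec)"
    then have i: "i < m" by simp
    define D where "D = down m E i"
    define S :: "real mat" where "S = selector m D"
    define C where "C = compression m D g"
    have D: "D \<subseteq> {..<m}" and iD: "i \<in> D"
      using down_subset self_in_down[OF i] by (auto simp: D_def)
    have S: "S \<in> carrier_mat (card D) m" and C: "C \<in> carrier_mat (card D) (card D)"
      using g by (auto simp: S_def C_def)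
    obtain k where k: "k \<in> carrier_mat (card D) (card D)" "C * k = 1\<^sub>m (card D)"
      using inv[OF i] by (auto simp: D_def C_def)
    have kC: "k * C = 1\<^sub>m (card D)"
      by (rule mat_mult_left_right_inverse[OF C k])
    have Sv: "S *\<^sub>v v \<in> carrier_vec (card D)"
      using S v by simp
    have CS: "C * S = S * g"
      unfolding C_def S_def
      by (rule compression_mult_selector[OF D g]) (unfold D_def, rule order_pattern_zero_on_down[OF zero])
    have "C *\<^sub>v (S *\<^sub>v v) = S *\<^sub>v (g *\<^sub>v v)"
      using assoc_mult_mat_vec[OF C S v] assoc_mult_mat_vec[OF S g v] CS by simp
    also have "\<dots> = 0\<^sub>v (card D)"
      using S gv by auto
    finally have "k *\<^sub>v (C *\<^sub>v (S *\<^sub>v v)) = 0\<^sub>v (card D)"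
      using k(1) by auto
    then have "S *\<^sub>v v = 0\<^sub>v (card D)"
      using assoc_mult_mat_vec[OF k(1) C Sv] kC Sv by simp
    moreover have "(S *\<^sub>v v) $ card {a \<in> D. a < i} = v $ i"
    proof -
      \<comment> \<open>\<open>v\<close> as a matrix with one column, for which the entries are known.\<close>
      define V where "V = mat_of_cols m [v]"
      have V: "V \<in> carrier_mat m 1" and colV: "col V 0 = v"
        using v by (auto simp: V_def)
      have a: "card {a \<in> D. a < i} < card D"
        using card_less_lt_card[OF finite_subset[OF D] iD] by simp
      have "(S *\<^sub>v v) $ card {a \<in> D. a < i} = (S * V) $$ (card {a \<in> D. a < i}, 0)"
        using a S V colV by simp
      also have "\<dots> = V $$ (i, 0)"
        unfolding S_def by (rule selector_mult_index_rank[OF D V iD]) simp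
      also have "\<dots> = v $ i"
        using colV V i by (auto simp: col_def)
      finally show ?thesis .
    qed
    ultimately show "v $ i = 0\<^sub>v m $ i"
      using card_less_lt_card[OF finite_subset[OF D] iD] i by simp
  qed (use v in auto)
  then have "det g \<noteq> 0"
    using det_0_iff_vec_prod_zero_field[OF g] by blast
  then show ?thesis
    using det_nonzero_imp_invertible_mat[OF g] g zero by (simp add: G0_def)
qed

section \<open>The maximal invariant\<close>

lemma U_iff:
  "x \<in> U m n E \<longleftrightarrow> x \<in> carrier_mat m n \<and>
     (\<forall>i<m. \<exists>R\<in>carrier_mat n (card (down m E i)).
        selector m (down m E i) * x * R = 1\<^sub>m (card (down m E i)))"
proof (cases "x \<in> carrier_mat m n")
  case True
  have "selector m (down m E i) * x \<in> carrier_mat (card (down m E i)) n" for i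
    using True by simp
  then show ?thesis
    unfolding U_def using True
    by (simp add: submatrix_conv_selector_mult[OF down_subset True] full_row_rank_iff_right_inverse[where n = n])
qed (simp add: U_def)

lemma tau_class:
  assumes "i < m" "x \<in> carrier_mat m n"
  shows "tau m E x (sim m E `` {i}) = row_proj (selector m (down m E i) * x)"
  using assms by (simp add: tau_def quotientI down_class_eq submatrix_conv_selector_mult[OF down_subset])

lemma tau_eq_iff:
  assumes "x \<in> carrier_mat m n" "y \<in> carrier_mat m n"
  shows "tau m E x = tau m E y \<longleftrightarrow>
    (\<forall>i<m. row_proj (selector m (down m E i) * x) = row_proj (selector m (down m E i) * y))"
proof
  assume "tau m E x = tau m E y"
  then show "\<forall>i<m. row_proj (selector m (down m E i) * x) = row_proj (selector m (down m E i) * y)"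
    using tau_class assms by metis
next
  assume *: "\<forall>i<m. row_proj (selector m (down m E i) * x) = row_proj (selector m (down m E i) * y)"
  show "tau m E x = tau m E y"
  proof
    fix C
    show "tau m E x C = tau m E y C"
    proof (cases "C \<in> {..<m} // sim m E")
      case True
      then obtain i where "i < m" "C = sim m E `` {i}"
        by (auto elim: quotientE)
      then show ?thesis
        using * tau_class assms by metis
    qed (simp add: tau_def)
  qed
qed

lemma tau_funcset:
  "tau m E \<in> U m n E \<rightarrow> (\<Pi>\<^sub>E C\<in>{..<m} // sim m E. carrier_mat n n)"
proof (intro funcsetI PiE_I)
  fix x C assume x: "x \<in> U m n E" and C: "C \<in> {..<m} // sim m E"
  obtain i where i: "i < m" "C = sim m E `` {i}"
    using C by (auto elim: quotientE)
  have xc: "x \<in> carrier_mat m n"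
    using x by (simp add: U_iff)
  obtain R where "R \<in> carrier_mat n (card (down m E i))"
      "selector m (down m E i) * x * R = 1\<^sub>m (card (down m E i))"
    using x i(1) by (auto simp: U_iff)
  then have "row_proj (selector m (down m E i) * x) \<in> carrier_mat n n"
    using xc by (intro row_proj_carrier[of _ "card (down m E i)" n R]) auto
  then show "tau m E x C \<in> carrier_mat n n"
    using tau_class[OF i(1) xc] i(2) by simp
qed (simp add: tau_def)

lemma G0_invariance:
  assumes g: "g \<in> G0 m E" and x: "x \<in> U m n E"
  shows "g * x \<in> U m n E" and "tau m E (g * x) = tau m E x"
proof -
  have gc: "g \<in> carrier_mat m m"
    and zero: "\<forall>i<m. \<forall>j<m. \<not> preceq m E j i \<longrightarrow> g $$ (i, j) = 0"
    and ginv: "invertible_mat g"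
    using g by (auto simp: G0_def)
  have xc: "x \<in> carrier_mat m n"
    using x by (simp add: U_iff)
  obtain g' where g': "g' \<in> carrier_mat m m" "g * g' = 1\<^sub>m m"
    using invertible_mat_right_inverse[OF ginv gc] .
  have *: "(\<exists>R\<in>carrier_mat n (card D). selector m D * (g * x) * R = 1\<^sub>m (card D)) \<and>
      row_proj (selector m D * (g * x)) = row_proj (selector m D * x)"
    if i: "i < m" and D_def: "D = down m E i" for i D
  proof -
    have D: "D \<subseteq> {..<m}"
      using down_subset by (simp add: D_def)
    have zD: "\<forall>k\<in>D. \<forall>j<m. j \<notin> D \<longrightarrow> g $$ (k, j) = 0"
      unfolding D_def by (rule order_pattern_zero_on_down[OF zero])
    have Sx: "selector m D * x \<in> carrier_mat (card D) n"
      using xc by simp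
    obtain R where R: "R \<in> carrier_mat n (card D)" "selector m D * x * R = 1\<^sub>m (card D)"
      using x i by (auto simp: U_iff D_def)
    note h = compression_carrier[OF gc, of D] compression_carrier[OF g'(1), of D]
      compression_right_inverse[OF D gc zD g']
    show ?thesis
      using row_proj_mult_left[OF Sx R h] R(1) h(2)
      unfolding compression_mult[OF D gc zD xc] by (meson mult_carrier_mat)
  qed
  show "g * x \<in> U m n E"
    using * gc xc by (auto simp: U_iff)
  show "tau m E (g * x) = tau m E x"
    using * gc xc by (subst tau_eq_iff[of _ m n]) auto
qed

text \<open>
  Only row \<open>i\<close> of the identity \<open>y[\<down>i] = h\<^sub>i x[\<down>i]\<close> is used to build row \<open>i\<close> of \<open>g\<close>. That all
  the blocks of \<open>g\<close> are invertible follows afterwards from \<open>g x = y\<close>: if \<open>Q\<close> is a right inverse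
  of \<open>y[\<down>i]\<close>, then \<open>x[\<down>i] Q\<close> is one of the block on \<open>\<down>i\<close>.
\<close>

lemma tau_eq_imp_same_orbit:
  assumes x: "x \<in> U m n E" and y: "y \<in> U m n E" and eq: "tau m E x = tau m E y"
  shows "\<exists>g\<in>G0 m E. g * x = y"
proof -
  let ?S = "\<lambda>i. selector m (down m E i) :: real mat"
  let ?d = "\<lambda>i. card (down m E i)"
  let ?a = "\<lambda>i. card {a \<in> down m E i. a < i}"
  have xc: "x \<in> carrier_mat m n" and yc: "y \<in> carrier_mat m n"
    using x y by (auto simp: U_iff)
  have a: "?a i < ?d i" if "i < m" for i
    using card_less_lt_card[OF finite_subset[OF down_subset] self_in_down[OF that]] by simp
  have "\<exists>h\<in>carrier_mat (?d i) (?d i). ?S i * y = h * (?S i * x)" if i: "i < m" for i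
  proof -
    obtain R where R: "R \<in> carrier_mat n (?d i)" "?S i * x * R = 1\<^sub>m (?d i)"
      using x i by (auto simp: U_iff)
    obtain Q where Q: "Q \<in> carrier_mat n (?d i)" "?S i * y * Q = 1\<^sub>m (?d i)"
      using y i by (auto simp: U_iff)
    have "?S i * x \<in> carrier_mat (?d i) n" "?S i * y \<in> carrier_mat (?d i) n"
      using xc yc by auto
    moreover have "row_proj (?S i * x) = row_proj (?S i * y)"
      using eq i tau_eq_iff[OF xc yc] by blast
    ultimately show ?thesis
      using row_proj_eq_imp_factor R Q by metis
  qed
  then obtain h where h: "\<And>i. i < m \<Longrightarrow> h i \<in> carrier_mat (?d i) (?d i)"
      "\<And>i. i < m \<Longrightarrow> ?S i * y = h i * (?S i * x)"
    by metis
  \<comment> \<open>Row \<open>i\<close> of \<open>g\<close> is the row of \<open>h i\<close> that belongs to the vertex \<open>i\<close>, extended by zeros.\<close>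
  define g where "g = mat m m (\<lambda>(i, j). (h i * ?S i) $$ (?a i, j))"
  have gc: "g \<in> carrier_mat m m"
    by (simp add: g_def)
  have zero: "\<forall>i<m. \<forall>j<m. \<not> preceq m E j i \<longrightarrow> g $$ (i, j) = 0"
  proof (intro allI impI)
    fix i j assume i: "i < m" and j: "j < m" and "\<not> preceq m E j i"
    then have "j \<notin> down m E i"
      by (simp add: down_def)
    then have "?S i $$ (b, j) = 0" if "b < ?d i" for b
      using pick_in_set[of b "down m E i"] that j by (auto simp: selector_def)
    then have "col (?S i) j = 0\<^sub>v (?d i)"
      using j by (intro eq_vecI) (auto simp: selector_def)
    then show "g $$ (i, j) = 0"
      using i j a[OF i] h(1)[OF i] by (auto simp: g_def selector_def)
  qed
  have gx: "g * x = y"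
  proof (rule eq_matI)
    fix i j assume "i < dim_row y" "j < dim_col y"
    then have i: "i < m" and j: "j < n"
      using yc by auto
    have hS: "h i * ?S i \<in> carrier_mat (?d i) m"
      using h(1)[OF i] by simp
    have "row g i = row (h i * ?S i) (?a i)"
      using i a[OF i] hS by (intro eq_vecI) (auto simp: g_def)
    then have "(g * x) $$ (i, j) = (h i * ?S i * x) $$ (?a i, j)"
      using i j a[OF i] h(1)[OF i] gc xc by simp
    also have "h i * ?S i * x = h i * (?S i * x)"
      using h(1)[OF i] xc by (intro assoc_mult_mat) auto
    also have "\<dots> $$ (?a i, j) = y $$ (i, j)"
      unfolding h(2)[OF i, symmetric]
      by (rule selector_mult_index_rank[OF down_subset yc self_in_down[OF i] j])
    finally show "(g * x) $$ (i, j) = y $$ (i, j)" .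
  qed (use gc xc yc in auto)
  have "\<exists>k\<in>carrier_mat (?d i) (?d i). compression m (down m E i) g * k = 1\<^sub>m (?d i)"
    if i: "i < m" for i
  proof -
    obtain Q where Q: "Q \<in> carrier_mat n (?d i)" "?S i * y * Q = 1\<^sub>m (?d i)"
      using y i by (auto simp: U_iff)
    have "compression m (down m E i) g * (?S i * x) = ?S i * y"
      unfolding gx[symmetric]
      by (rule compression_mult[OF down_subset gc order_pattern_zero_on_down[OF zero] xc])
    moreover have "compression m (down m E i) g * (?S i * x * Q)
        = compression m (down m E i) g * (?S i * x) * Q"
      using gc xc Q(1) by (intro assoc_mult_mat[symmetric, of _ "?d i" "?d i" _ n]) auto
    ultimately have "compression m (down m E i) g * (?S i * x * Q) = 1\<^sub>m (?d i)"
      using Q(2) by simp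
    moreover have "?S i * x * Q \<in> carrier_mat (?d i) (?d i)"
      using mult_carrier_mat[OF selector_mult_carrier[OF xc] Q(1)] .
    ultimately show ?thesis by blast
  qed
  then have "g \<in> G0 m E"
    using gc zero by (intro G0I) auto
  then show ?thesis
    using gx by blast
qed

theorem theorem1p3:
  fixes m n :: nat and E :: "nat set set"
  assumes "m \<ge> 1" and "n \<ge> 1"
    and "simple_graph m E"
    and "n \<ge> Max ((\<lambda>i. card (down m E i)) ` {..<m})"
  shows "tau m E \<in> U m n E \<rightarrow> (\<Pi>\<^sub>E C\<in>{..<m} // sim m E. carrier_mat n n)
    \<and> maximal_invariant (G0 m E) (\<lambda>g x. g * x) (U m n E) (tau m E)"
  unfolding maximal_invariant_def
  by (intro conjI ballI impI) (fact tau_funcset G0_invariance tau_eq_imp_same_orbit)+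

end
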